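(* For all real numbers $a,b>0$ and $v\in(0,1)$, $$a\sharp_v b\le\left(a\sharp_{\frac{v}{2}}b\right)\nabla_v\left(a\sharp_{\frac{1+v}{2}}b\right)\le L_v(a,b)\le\left(a\nabla_v b\right)\nabla\left(a\sharp_v b\right)\le a\nabla_v b.$$
   Context: For real numbers $x,y>0$ and $w\in[0,1]$: $x\sharp_w y:=x^{1-w}y^w$ (weighted geometric mean), $x\nabla_w y:=(1-w)x+wy$ (weighted arithmetic mean), and $\nabla:=\nabla_{1/2}$. The weighted logarithmic mean of $a,b>0$ with weight $v\in(0,1)$ is, for $a\ne b$, $$L_v(a,b):=\frac{1}{\log a-\log b}\left(\frac{1-v}{v}\left(a-a^{1-v}b^v\right)+\frac{v}{1-v}\left(a^{1-v}b^v-b\right)\right),$$ and $L_v(a,a):=a$. *)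

theory Defs
  imports Complex_Main
begin

text \<open>The means below are meant for positive arguments; weights of the geometric and arithmetic
  means range over \<open>[0,1]\<close>, the weight of the logarithmic mean over the open interval \<open>(0,1)\<close>.\<close>

definition wgeom_mean :: "real \<Rightarrow> real \<Rightarrow> real \<Rightarrow> real"  (\<open>_ \<sharp>\<^bsub>_\<^esub> _\<close> [71, 0, 71] 70)
  where "x \<sharp>\<^bsub>w\<^esub> y = x powr (1 - w) * y powr w"

definition warith_mean :: "real \<Rightarrow> real \<Rightarrow> real \<Rightarrow> real"  (\<open>_ \<nabla>\<^bsub>_\<^esub> _\<close> [71, 0, 71] 70)
  where "x \<nabla>\<^bsub>w\<^esub> y = (1 - w) * x + w * y"

abbreviation arith_mean :: "real \<Rightarrow> real \<Rightarrow> real"  (\<open>_ \<nabla> _\<close> [71, 71] 70)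
  where "x \<nabla> y \<equiv> x \<nabla>\<^bsub>1/2\<^esub> y"

definition wlog_mean :: "real \<Rightarrow> real \<Rightarrow> real \<Rightarrow> real"
  where "wlog_mean v a b =
    (if a = b then a
     else 1 / (ln a - ln b) *
       ((1 - v) / v * (a - a powr (1 - v) * b powr v)
        + v / (1 - v) * (a powr (1 - v) * b powr v - b)))"

end

theory Submission
  imports Defs "HOL-Analysis.Convex"
begin

text \<open>Write \<open>m = a \<sharp>\<^bsub>v\<^esub> b\<close>. On the logarithmic scale \<open>m\<close> divides the segment from \<open>a\<close> to \<open>b\<close> in the
  ratio \<open>v : 1 - v\<close>, so \<open>ln a - ln m = v (ln a - ln b)\<close> and \<open>ln m - ln b = (1 - v) (ln a - ln b)\<close>.
  These two factors are exactly the denominators in the weighted logarithmic mean, which is therefore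
  the weighted arithmetic mean of the ordinary logarithmic means of \<open>a, m\<close> and of \<open>m, b\<close>
  (\<open>wlog_mean_eq_warith_log_means\<close>).

  The two middle inequalities now follow by applying to each piece the classical fact that the
  logarithmic mean lies between the geometric and the arithmetic mean: the geometric means of the
  pieces are \<open>a \<sharp>\<^bsub>v/2\<^esub> b\<close> and \<open>a \<sharp>\<^bsub>(1+v)/2\<^esub> b\<close>, and the arithmetic means of the pieces average to
  \<open>(a \<nabla>\<^bsub>v\<^esub> b) \<nabla> m\<close>. The two outer inequalities are the weighted arithmetic-geometric mean inequality:
  the first one because \<open>m\<close> is the \<open>v\<close>-weighted geometric mean of the two geometric means just named,
  the last one directly for \<open>a\<close> and \<open>b\<close>.\<close>

definition log_mean :: "real \<Rightarrow> real \<Rightarrow> real"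
  where "log_mean x y = (if x = y then x else (x - y) / (ln x - ln y))"

text \<open>The derivatives of \<open>sinh x - x\<close> and \<open>x * cosh x - sinh x\<close> are \<open>cosh x - 1\<close> and
  \<open>x * sinh x\<close>, which are nonnegative for \<open>x \<ge> 0\<close>.\<close>

lemma le_sinh_real:
  fixes h :: real
  assumes "0 \<le> h"
  shows "h \<le> sinh h"
proof -
  have "sinh 0 - 0 \<le> sinh h - h"
  proof (rule DERIV_nonneg_imp_nondecreasing[OF assms])
    fix x :: real
    have "((\<lambda>x. sinh x - x) has_real_derivative cosh x - 1) (at x)"
      by (auto intro!: derivative_eq_intros)
    then show "\<exists>y. ((\<lambda>x. sinh x - x) has_real_derivative y) (at x) \<and> 0 \<le> y"
      using cosh_real_ge_1[of x] by auto
  qed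
  then show ?thesis by simp
qed

lemma sinh_le_mult_cosh_real:
  fixes h :: real
  assumes "0 \<le> h"
  shows "sinh h \<le> h * cosh h"
proof -
  have "0 * cosh 0 - sinh 0 \<le> h * cosh h - sinh h"
  proof (rule DERIV_nonneg_imp_nondecreasing[OF assms])
    fix x :: real
    assume "0 \<le> x"
    have "((\<lambda>x. x * cosh x - sinh x) has_real_derivative x * sinh x) (at x)"
      by (auto intro!: derivative_eq_intros)
    then show "\<exists>y. ((\<lambda>x. x * cosh x - sinh x) has_real_derivative y) (at x) \<and> 0 \<le> y"
      using \<open>0 \<le> x\<close> by auto
  qed
  then show ?thesis by simp
qed

lemma wgeom_mean_exp: "exp p \<sharp>\<^bsub>w\<^esub> exp q = exp ((1 - w) * p + w * q)"
  by (simp add: wgeom_mean_def powr_def exp_add)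

lemma wgeom_mean_pos: "0 < x \<Longrightarrow> 0 < y \<Longrightarrow> 0 < x \<sharp>\<^bsub>w\<^esub> y"
  by (simp add: wgeom_mean_def)

lemma ln_wgeom_mean: "0 < x \<Longrightarrow> 0 < y \<Longrightarrow> ln (x \<sharp>\<^bsub>w\<^esub> y) = (1 - w) * ln x + w * ln y"
  by (simp add: wgeom_mean_def ln_mult ln_powr)

lemma wgeom_mean_wgeom_means:
  assumes "0 < a" "0 < b"
  shows "(a \<sharp>\<^bsub>s\<^esub> b) \<sharp>\<^bsub>w\<^esub> (a \<sharp>\<^bsub>t\<^esub> b) = a \<sharp>\<^bsub>(1 - w) * s + w * t\<^esub> b"
proof -
  have "ln ((a \<sharp>\<^bsub>s\<^esub> b) \<sharp>\<^bsub>w\<^esub> (a \<sharp>\<^bsub>t\<^esub> b)) = ln (a \<sharp>\<^bsub>(1 - w) * s + w * t\<^esub> b)"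
    using assms by (simp add: ln_wgeom_mean wgeom_mean_pos algebra_simps)
  then show ?thesis
    using assms by (simp add: wgeom_mean_pos)
qed

lemma wgeom_mean_0: "0 < a \<Longrightarrow> 0 < b \<Longrightarrow> a \<sharp>\<^bsub>0\<^esub> b = a"
  and wgeom_mean_1: "0 < a \<Longrightarrow> 0 < b \<Longrightarrow> a \<sharp>\<^bsub>1\<^esub> b = b"
  by (simp_all add: wgeom_mean_def)

lemma wgeom_mean_le_warith_mean:
  assumes "0 < x" "0 < y" "0 \<le> w" "w \<le> 1"
  shows "x \<sharp>\<^bsub>w\<^esub> y \<le> x \<nabla>\<^bsub>w\<^esub> y"
  unfolding wgeom_mean_def warith_mean_def
  using Youngs_inequality_0[of "1 - w" w x y] assms by simp

lemma warith_mean_mono: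
  assumes "x \<le> x'" "y \<le> y'" "0 \<le> w" "w \<le> 1"
  shows "x \<nabla>\<^bsub>w\<^esub> y \<le> x' \<nabla>\<^bsub>w\<^esub> y'"
  unfolding warith_mean_def using assms by (intro add_mono mult_left_mono) auto

lemma log_mean_exp:
  assumes "h \<noteq> 0"
  shows "log_mean (exp (c + h)) (exp (c - h)) = exp c * (sinh h / h)"
proof -
  have "exp (c + h) - exp (c - h) = exp c * (2 * sinh h)"
    by (simp add: sinh_field_def exp_add exp_diff exp_minus field_simps)
  then show ?thesis
    using assms by (simp add: log_mean_def)
qed

lemma log_mean_commute: "log_mean x y = log_mean y x"
proof (cases "x = y")
  case False
  then show ?thesis
    using minus_divide_divide[of "x - y" "ln x - ln y"] by (simp add: log_mean_def)
qed simp

lemma wgeom_mean_half_commute: "x \<sharp>\<^bsub>1/2\<^esub> y = y \<sharp>\<^bsub>1/2\<^esub> x"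
  by (simp add: wgeom_mean_def)

text \<open>With \<open>c\<close> the midpoint and \<open>h\<close> half the difference of \<open>ln x\<close> and \<open>ln y\<close>, dividing by the
  geometric mean \<open>exp c\<close> turns the geometric, logarithmic and arithmetic means into \<open>1\<close>,
  \<open>sinh h / h\<close> and \<open>cosh h\<close>. All three means are symmetric, so \<open>h > 0\<close> may be assumed when
  \<open>x \<noteq> y\<close>.\<close>

lemma log_mean_between_geom_arith:
  assumes "0 < x" "0 < y"
  shows "x \<sharp>\<^bsub>1/2\<^esub> y \<le> log_mean x y \<and> log_mean x y \<le> x \<nabla> y"
proof -
  have less: "x \<sharp>\<^bsub>1/2\<^esub> y \<le> log_mean x y \<and> log_mean x y \<le> x \<nabla> y"
    if "0 < y" "y < x" for x y :: real
  proof -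
    define c h where "c = (ln x + ln y) / 2" and "h = (ln x - ln y) / 2"
    have "0 < h" using that by (simp add: h_def)
    have "c + h = ln x" "c - h = ln y"
      by (simp_all add: c_def h_def field_simps)
    then have xy: "x = exp (c + h)" "y = exp (c - h)" using that by simp_all
    have "x \<sharp>\<^bsub>1/2\<^esub> y = exp c * 1"
      unfolding xy by (simp add: wgeom_mean_exp field_simps)
    moreover have "log_mean x y = exp c * (sinh h / h)"
      unfolding xy using \<open>0 < h\<close> by (simp add: log_mean_exp)
    moreover have "x \<nabla> y = exp c * cosh h"
      unfolding xy by (simp add: warith_mean_def cosh_field_def exp_add exp_diff exp_minus field_simps)
    moreover have "1 \<le> sinh h / h" "sinh h / h \<le> cosh h"
      using \<open>0 < h\<close> le_sinh_real[of h] sinh_le_mult_cosh_real[of h] by (simp_all add: field_simps)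
    ultimately show ?thesis by (simp only: mult_left_mono exp_ge_zero)
  qed
  consider "y < x" | "x < y" | "x = y" by linarith
  then show ?thesis
  proof cases
    case 1
    then show ?thesis using less assms by simp
  next
    case 2
    then have "y \<sharp>\<^bsub>1/2\<^esub> x \<le> log_mean y x \<and> log_mean y x \<le> y \<nabla> x"
      using less assms by simp
    then show ?thesis
      by (simp add: log_mean_commute[of y] wgeom_mean_half_commute[of y] warith_mean_def add.commute)
  next
    case 3
    then show ?thesis
      using assms by (simp add: log_mean_def wgeom_mean_def warith_mean_def flip: powr_add)
  qed
qed

text \<open>Since \<open>ln (a \<sharp>\<^bsub>v\<^esub> b)\<close> divides the segment from \<open>ln a\<close> to \<open>ln b\<close> in the ratio \<open>v : 1 - v\<close>,
  the weights \<open>1 / v\<close> and \<open>1 / (1 - v)\<close> in the weighted logarithmic mean only rescale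
  \<open>ln a - ln b\<close> to the logarithmic differences of the two pieces.\<close>

lemma wlog_mean_eq_warith_log_means:
  assumes "0 < a" "0 < b" "0 < v" "v < 1"
  shows "wlog_mean v a b = log_mean a (a \<sharp>\<^bsub>v\<^esub> b) \<nabla>\<^bsub>v\<^esub> log_mean (a \<sharp>\<^bsub>v\<^esub> b) b"
proof (cases "a = b")
  case True
  then show ?thesis
    using assms by (simp add: wlog_mean_def log_mean_def warith_mean_def wgeom_mean_def algebra_simps flip: powr_add)
next
  case False
  define m where "m = a \<sharp>\<^bsub>v\<^esub> b"
  define d where "d = ln a - ln b"
  have "d \<noteq> 0" using False assms by (simp add: d_def)
  have am: "ln a - ln m = v * d" and mb: "ln m - ln b = (1 - v) * d"
    using assms by (simp_all add: m_def d_def ln_wgeom_mean algebra_simps)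
  have "a \<noteq> m" "m \<noteq> b"
    using am mb \<open>d \<noteq> 0\<close> assms by auto
  then have "log_mean a m = (a - m) / (v * d)" "log_mean m b = (m - b) / ((1 - v) * d)"
    by (simp_all only: log_mean_def am mb if_False)
  moreover have "wlog_mean v a b = 1 / d * ((1 - v) / v * (a - m) + v / (1 - v) * (m - b))"
    using False by (simp add: wlog_mean_def m_def d_def wgeom_mean_def)
  ultimately show ?thesis
    using \<open>d \<noteq> 0\<close> assms by (simp add: m_def[symmetric] warith_mean_def distrib_left mult.commute)
qed

theorem corollary2p2:
  fixes a b v :: real
  assumes "a > 0" and "b > 0" and "0 < v" and "v < 1"
  shows "a \<sharp>\<^bsub>v\<^esub> b \<le> (a \<sharp>\<^bsub>v / 2\<^esub> b) \<nabla>\<^bsub>v\<^esub> (a \<sharp>\<^bsub>(1 + v) / 2\<^esub> b)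
    \<and> (a \<sharp>\<^bsub>v / 2\<^esub> b) \<nabla>\<^bsub>v\<^esub> (a \<sharp>\<^bsub>(1 + v) / 2\<^esub> b) \<le> wlog_mean v a b
    \<and> wlog_mean v a b \<le> (a \<nabla>\<^bsub>v\<^esub> b) \<nabla> (a \<sharp>\<^bsub>v\<^esub> b)
    \<and> (a \<nabla>\<^bsub>v\<^esub> b) \<nabla> (a \<sharp>\<^bsub>v\<^esub> b) \<le> a \<nabla>\<^bsub>v\<^esub> b"
proof (intro conjI)
  define m where "m = a \<sharp>\<^bsub>v\<^esub> b"
  have "0 < m" using assms by (simp add: m_def wgeom_mean_pos)
  have wlog: "wlog_mean v a b = log_mean a m \<nabla>\<^bsub>v\<^esub> log_mean m b"
    using assms by (simp add: m_def wlog_mean_eq_warith_log_means)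
  have am: "a \<sharp>\<^bsub>v / 2\<^esub> b = a \<sharp>\<^bsub>1/2\<^esub> m"
    using wgeom_mean_wgeom_means[of a b 0 "1/2" v] assms by (simp add: m_def wgeom_mean_0)
  have mb: "a \<sharp>\<^bsub>(1 + v) / 2\<^esub> b = m \<sharp>\<^bsub>1/2\<^esub> b"
    using wgeom_mean_wgeom_means[of a b v "1/2" 1] assms
    by (simp add: m_def wgeom_mean_1 add_divide_distrib add.commute)
  \<comment> \<open>The exponents average to \<open>(1 - v) * v/2 + v * (1 + v)/2 = v\<close>.\<close>
  have "a \<sharp>\<^bsub>v\<^esub> b = (a \<sharp>\<^bsub>v / 2\<^esub> b) \<sharp>\<^bsub>v\<^esub> (a \<sharp>\<^bsub>(1 + v) / 2\<^esub> b)"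
    using assms by (simp add: wgeom_mean_wgeom_means field_simps)
  also have "\<dots> \<le> (a \<sharp>\<^bsub>v / 2\<^esub> b) \<nabla>\<^bsub>v\<^esub> (a \<sharp>\<^bsub>(1 + v) / 2\<^esub> b)"
    using assms by (intro wgeom_mean_le_warith_mean wgeom_mean_pos) auto
  finally show "a \<sharp>\<^bsub>v\<^esub> b \<le> (a \<sharp>\<^bsub>v / 2\<^esub> b) \<nabla>\<^bsub>v\<^esub> (a \<sharp>\<^bsub>(1 + v) / 2\<^esub> b)" .
  show "(a \<sharp>\<^bsub>v / 2\<^esub> b) \<nabla>\<^bsub>v\<^esub> (a \<sharp>\<^bsub>(1 + v) / 2\<^esub> b) \<le> wlog_mean v a b"
    unfolding wlog am mb using log_mean_between_geom_arith \<open>0 < m\<close> assms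
    by (intro warith_mean_mono) auto
  have "wlog_mean v a b \<le> (a \<nabla> m) \<nabla>\<^bsub>v\<^esub> (m \<nabla> b)"
    unfolding wlog using log_mean_between_geom_arith \<open>0 < m\<close> assms
    by (intro warith_mean_mono) auto
  also have "\<dots> = (a \<nabla>\<^bsub>v\<^esub> b) \<nabla> m"
    by (simp add: warith_mean_def field_simps)
  finally show "wlog_mean v a b \<le> (a \<nabla>\<^bsub>v\<^esub> b) \<nabla> (a \<sharp>\<^bsub>v\<^esub> b)"
    by (simp only: m_def)
  have "a \<sharp>\<^bsub>v\<^esub> b \<le> a \<nabla>\<^bsub>v\<^esub> b"
    using assms by (intro wgeom_mean_le_warith_mean) auto
  then show "(a \<nabla>\<^bsub>v\<^esub> b) \<nabla> (a \<sharp>\<^bsub>v\<^esub> b) \<le> a \<nabla>\<^bsub>v\<^esub> b"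
    unfolding warith_mean_def[of "a \<nabla>\<^bsub>v\<^esub> b"] by simp
qed

end
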